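(* Let $p>1$, let $\rho=(\rho_m)$ and $\pi=(\pi_n)$ be sequences of partitions of $[0,T]$ with vanishing mesh, and let $x\in C([0,T];\mathbb R)\cap V_p(\rho)$. Then $$x\in V_p(\pi)\ \text{ and }\ [x]^p_\pi=[x]^p_\rho\quad\Longleftrightarrow\quad x\in\mathcal D^p_{\pi\mid\rho}.$$ If the left-hand side holds, then for every alignment $\rho^\star$ of $\rho$ with $\pi$ along $x$, $$\sup_{t\in[0,T]}\bigl|\mathsf R^p_{\pi,\rho^\star;n}(x;t)\bigr|\longrightarrow0\qquad(n\to\infty).$$
   Context: $\omega_x(h):=\sup\{|x(t)-x(s)|:s,t\in[0,T],|t-s|\le h\}$. $N(\lambda)$ is the number of intervals of a partition $\lambda$ and $|\lambda|$ its mesh. Finite $p$-th variation: for a partition sequence $\lambda=(\lambda_n)$, $\lambda_n=\{0=u^n_0<\dots<u^n_{N(\lambda_n)}=T\}$, with vanishing mesh, $x\in V_p(\lambda)$ means that the measures $\sum_i|x(u^n_{i+1})-x(u^n_i)|^p\delta_{u^n_i}$ converge weakly to a finite nonatomic Borel measure $\mu^{p,x}_\lambda$ on $[0,T]$; then $[x]^p_\lambda(t):=\mu_\lambda^{p,x}([0,t])$. Alignment: for a strictly increasing $r:\mathbb N\to\mathbb N$ put $\rho^\star_n:=\rho_{r(n)}$, $h_n:=|\rho^\star_n|$. The subsequence $\rho^\star$ is an alignment of $\rho$ with $\pi$ along $x$ if $N(\pi_n)\,\omega_x(h_n)^p\to0$. Relative coarse-graining error: write $\pi_n=\{0=t^n_0<\dots<t^n_{N_n}=T\}$,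 $\rho^\star_n=\{0=s^n_0<\dots<s^n_{M_n}=T\}$, and $\kappa_n(0)=0$, $\kappa_n(N_n)=M_n$, $\kappa_n(k)=\min\{j:s^n_j\ge t^n_k\}$. Let $\delta_{j,n}(t):=x(s^n_{j+1}\wedge t)-x(s^n_j\wedge t)$, $C_{k,n}(t):=\sum_{j=\kappa_n(k)}^{\kappa_n(k+1)-1}\delta_{j,n}(t)$ (empty sums are $0$), and $$\mathsf R^p_{\pi,\rho^\star;n}(x;t):=\sum_{k=0}^{N_n-1}\Bigl(|C_{k,n}(t)|^p-\sum_{j=\kappa_n(k)}^{\kappa_n(k+1)-1}|\delta_{j,n}(t)|^p\Bigr).$$ For $x\in V_p(\rho)$, $x\in\mathcal D^p_{\pi\mid\rho}$ means that there exists an alignment $\rho^\star$ of $\rho$ with $\pi$ along $x$ such that $\mathsf R^p_{\pi,\rho^\star;n}(x;t)\to0$ as $n\to\infty$ for every $t\in[0,T]$. *)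

theory Defs
  imports "HOL-Analysis.Analysis"
begin

text \<open>A partition \<open>{0 = u 0 < \<dots> < u N = T}\<close> is the strictly increasing list of its \<open>N + 1\<close> points,
  so that \<open>us ! i\<close> is the \<open>i\<close>-th point.\<close>

definition is_partition :: "real \<Rightarrow> real list \<Rightarrow> bool" where
  "is_partition T us \<longleftrightarrow> us \<noteq> [] \<and> hd us = 0 \<and> last us = T \<and> sorted_wrt (<) us"

definition num_intervals :: "real list \<Rightarrow> nat" where
  "num_intervals us = length us - 1"

definition mesh :: "real list \<Rightarrow> real" where
  "mesh us = Max ((\<lambda>i. us ! Suc i - us ! i) ` {..<num_intervals us})"

definition vanishing_partitions :: "real \<Rightarrow> (nat \<Rightarrow> real list) \<Rightarrow> bool" where
  "vanishing_partitions T \<sigma> \<longleftrightarrow> (\<forall>n. is_partition T (\<sigma> n)) \<and> (\<lambda>n. mesh (\<sigma> n)) \<longlonglongrightarrow> 0"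

definition osc :: "real \<Rightarrow> (real \<Rightarrow> real) \<Rightarrow> real \<Rightarrow> real" where
  "osc T x h = Sup {\<bar>x t - x s\<bar> | s t. s \<in> {0..T} \<and> t \<in> {0..T} \<and> \<bar>t - s\<bar> \<le> h}"

text \<open>The measure \<open>\<Sum>i<N. \<bar>x (u (i+1)) - x (u i)\<bar>\<^sup>p \<delta>(u i)\<close> on the Borel sets of \<open>[0,T]\<close>, as the image
  under \<open>i \<mapsto> u i\<close> of the measure on \<open>{..<N}\<close> with these weights; see
  \<open>integral_variation_measure\<close> below.\<close>

definition variation_measure :: "real \<Rightarrow> real \<Rightarrow> (real \<Rightarrow> real) \<Rightarrow> real list \<Rightarrow> real measure" where
  "variation_measure T p x us =
     distr (point_measure {..<num_intervals us} (\<lambda>i. ennreal (\<bar>x (us ! Suc i) - x (us ! i)\<bar> powr p)))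
       (restrict_space borel {0..T}) (\<lambda>i. us ! i)"

text \<open>Continuous functions on the compact interval \<open>[0,T]\<close> are bounded, so these are all the
  bounded continuous test functions.\<close>

definition weakly_converges_on :: "real \<Rightarrow> (nat \<Rightarrow> real measure) \<Rightarrow> real measure \<Rightarrow> bool" where
  "weakly_converges_on T M \<mu> \<longleftrightarrow>
     (\<forall>f :: real \<Rightarrow> real. continuous_on {0..T} f \<longrightarrow> (\<lambda>n. integral\<^sup>L (M n) f) \<longlonglongrightarrow> integral\<^sup>L \<mu> f)"

definition nonatomic :: "'a measure \<Rightarrow> bool" where
  "nonatomic \<mu> \<longleftrightarrow> \<not> (\<exists>A\<in>sets \<mu>. emeasure \<mu> A > 0 \<and>
     (\<forall>B\<in>sets \<mu>. B \<subseteq> A \<longrightarrow> emeasure \<mu> B = 0 \<or> emeasure \<mu> B = emeasure \<mu> A))"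

definition is_variation_limit ::
    "real \<Rightarrow> real \<Rightarrow> (nat \<Rightarrow> real list) \<Rightarrow> (real \<Rightarrow> real) \<Rightarrow> real measure \<Rightarrow> bool" where
  "is_variation_limit T p \<sigma> x \<mu> \<longleftrightarrow>
     sets \<mu> = sets (restrict_space borel {0..T}) \<and> finite_measure \<mu> \<and> nonatomic \<mu> \<and>
     weakly_converges_on T (\<lambda>n. variation_measure T p x (\<sigma> n)) \<mu>"

definition finite_pvar :: "real \<Rightarrow> real \<Rightarrow> (nat \<Rightarrow> real list) \<Rightarrow> (real \<Rightarrow> real) set" where
  "finite_pvar T p \<sigma> = {x. \<exists>\<mu>. is_variation_limit T p \<sigma> x \<mu>}"

text \<open>\<open>[x]\<^sup>p(t)\<close> along \<open>\<sigma>\<close>. Weak limits of finite Borel measures on \<open>[0,T]\<close> are unique, so the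
  description is proper for every \<open>x \<in> finite_pvar T p \<sigma>\<close>.\<close>

definition pvar :: "real \<Rightarrow> real \<Rightarrow> (nat \<Rightarrow> real list) \<Rightarrow> (real \<Rightarrow> real) \<Rightarrow> real \<Rightarrow> real" where
  "pvar T p \<sigma> x t = measure (THE \<mu>. is_variation_limit T p \<sigma> x \<mu>) {0..t}"

text \<open>The index map \<open>r\<close> stands for the subsequence \<open>\<lambda>n. \<rho> (r n)\<close>.\<close>

definition is_alignment ::
    "real \<Rightarrow> real \<Rightarrow> (nat \<Rightarrow> real list) \<Rightarrow> (nat \<Rightarrow> real list) \<Rightarrow> (real \<Rightarrow> real) \<Rightarrow> (nat \<Rightarrow> nat) \<Rightarrow> bool" where
  "is_alignment T p \<pi> \<rho> x r \<longleftrightarrow> strict_mono r \<and>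
     (\<lambda>n. real (num_intervals (\<pi> n)) * osc T x (mesh (\<rho> (r n))) powr p) \<longlonglongrightarrow> 0"

definition kappa :: "real list \<Rightarrow> real list \<Rightarrow> nat \<Rightarrow> nat" where
  "kappa ts ss k =
     (if k = 0 then 0
      else if k = num_intervals ts then num_intervals ss
      else (LEAST j. j \<le> num_intervals ss \<and> ss ! j \<ge> ts ! k))"

definition stopped_incr :: "real list \<Rightarrow> (real \<Rightarrow> real) \<Rightarrow> nat \<Rightarrow> real \<Rightarrow> real" where
  "stopped_incr ss x j t = x (min (ss ! Suc j) t) - x (min (ss ! j) t)"

definition block_incr :: "real list \<Rightarrow> real list \<Rightarrow> (real \<Rightarrow> real) \<Rightarrow> nat \<Rightarrow> real \<Rightarrow> real" where
  "block_incr ts ss x k t = (\<Sum>j = kappa ts ss k..<kappa ts ss (Suc k). stopped_incr ss x j t)"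

definition coarse_graining_error ::
    "real \<Rightarrow> real list \<Rightarrow> real list \<Rightarrow> (real \<Rightarrow> real) \<Rightarrow> real \<Rightarrow> real" where
  "coarse_graining_error p ts ss x t =
     (\<Sum>k<num_intervals ts. \<bar>block_incr ts ss x k t\<bar> powr p
        - (\<Sum>j = kappa ts ss k..<kappa ts ss (Suc k). \<bar>stopped_incr ss x j t\<bar> powr p))"

definition coarse_graining_class ::
    "real \<Rightarrow> real \<Rightarrow> (nat \<Rightarrow> real list) \<Rightarrow> (nat \<Rightarrow> real list) \<Rightarrow> (real \<Rightarrow> real) set" where
  "coarse_graining_class T p \<pi> \<rho> = {x \<in> finite_pvar T p \<rho>.
     \<exists>r. is_alignment T p \<pi> \<rho> x r \<and>
       (\<forall>t\<in>{0..T}. (\<lambda>n. coarse_graining_error p (\<pi> n) (\<rho> (r n)) x t) \<longlonglongrightarrow> 0)}"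

lemma partition_nth_mem:
  assumes "is_partition T us" "i < length us"
  shows "us ! i \<in> {0..T}"
proof -
  have s: "sorted us"
    using assms(1) by (simp add: is_partition_def strict_sorted_iff)
  have "us ! 0 \<le> us ! i" "us ! i \<le> us ! (length us - 1)"
    using s assms(2) by (auto intro!: sorted_nth_mono)
  then show ?thesis
    using assms by (auto simp: is_partition_def hd_conv_nth last_conv_nth)
qed

lemma integral_variation_measure:
  fixes f :: "real \<Rightarrow> real"
  assumes "is_partition T us" and "continuous_on {0..T} f"
  shows "integral\<^sup>L (variation_measure T p x us) f =
    (\<Sum>i<num_intervals us. \<bar>x (us ! Suc i) - x (us ! i)\<bar> powr p * f (us ! i))"
proof -
  let ?w = "\<lambda>i. \<bar>x (us ! Suc i) - x (us ! i)\<bar> powr p"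
  let ?P = "point_measure {..<num_intervals us} (\<lambda>i. ennreal (?w i))"
  have u: "(\<lambda>i. us ! i) \<in> measurable ?P (restrict_space borel {0..T})"
  proof -
    have "\<And>i. i < num_intervals us \<Longrightarrow> us ! i \<in> {0..T}"
      by (rule partition_nth_mem[OF assms(1)]) (simp add: num_intervals_def)
    then show ?thesis
      by (auto simp: measurable_point_measure_eq1 space_restrict_space)
  qed
  have f: "f \<in> borel_measurable (restrict_space borel {0..T})"
    using assms(2) by (rule borel_measurable_continuous_on_restrict)
  have "integral\<^sup>L (variation_measure T p x us) f = integral\<^sup>L ?P (\<lambda>i. f (us ! i))"
    unfolding variation_measure_def by (rule integral_distr[OF u f])
  also have "\<dots> = (\<Sum>i<num_intervals us. ?w i * f (us ! i))"
    by (subst lebesgue_integral_point_measure_finite) auto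
  finally show ?thesis .
qed

end

theory Submission
  imports Defs "HOL-Probability.Distribution_Functions"
begin

text \<open>Stopping the partition at \<open>t\<close> changes the mass of \<open>[0,t]\<close> by at most one term, hence by at most
  \<open>osc T x (mesh us) powr p\<close>. Weak convergence to a nonatomic limit therefore amounts to pointwise
  convergence of the stopped \<open>p\<close>-variation to the distribution function of the limit, and this
  convergence is uniform because the distribution functions are monotone with continuous limit.

  The block increments telescope to increments of \<open>x\<close> between points of \<open>\<rho>\<^sup>*\<close> that lie within one mesh
  of the points of \<open>\<pi>\<close>. So they differ from the increments along \<open>\<pi>\<close> by at most twice the oscillation,
  and the alignment condition says exactly that these differences vanish in \<open>l\<^sup>p\<close>. Hence the
  coarse-graining error is, up to a vanishing term, the stopped \<open>p\<close>-variation along \<open>\<pi>\<close> minus the one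
  along \<open>\<rho>\<^sup>*\<close>.\<close>

subsection \<open>Weak convergence on an interval\<close>

text \<open>Polya's argument: on a finite grid fine enough for the uniform continuity of
  \<open>g\<close>, monotonicity traps \<open>F n t\<close> between values of \<open>F n\<close> at
  nearby grid points, where convergence is already known.\<close>

lemma mono_tendsto_imp_uniform_limit:
  fixes F :: "nat \<Rightarrow> real \<Rightarrow> real" and g :: "real \<Rightarrow> real"
  assumes mono: "\<And>n. mono_on {a..b} (F n)"
    and lim: "\<And>t. t \<in> {a..b} \<Longrightarrow> (\<lambda>n. F n t) \<longlonglongrightarrow> g t"
    and cont: "continuous_on {a..b} g"
  shows "uniform_limit {a..b} F g sequentially"
proof (rule uniform_limitI)
  fix e :: real assume e: "e > 0"
  have "uniformly_continuous_on {a..b} g"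
    using cont by (simp add: compact_uniformly_continuous)
  then obtain d where d: "d > 0"
    "\<And>s t. s \<in> {a..b} \<Longrightarrow> t \<in> {a..b} \<Longrightarrow> \<bar>t - s\<bar> < d \<Longrightarrow> \<bar>g t - g s\<bar> < e / 2"
    using half_gt_zero[OF e] unfolding dist_real_def by (rule uniformly_continuous_onE) (auto simp: dist_real_def)
  have "seq_compact {a..b}"
    by (simp add: compact_imp_seq_compact)
  from seq_compact_imp_totally_bounded[OF this, rule_format, OF half_gt_zero[OF d(1)]]
  obtain C where C: "finite C" "C \<subseteq> {a..b}" "{a..b} \<subseteq> (\<Union>c\<in>C. ball c (d / 2))"
    by (elim exE conjE) (rule that)
  \<comment> \<open>The ends of the ball around \<open>c\<close>, clipped to \<open>{a..b}\<close>.
    They enclose every \<open>t\<close> of that ball at distance below \<open>d\<close>, and there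
    are finitely many of them, so pointwise convergence holds at all of them simultaneously.\<close>
  let ?l = "\<lambda>c. max a (c - d / 2)" and ?u = "\<lambda>c. min b (c + d / 2)"
  have ev: "\<forall>\<^sub>F n in sequentially. \<bar>F n t - g t\<bar> < e / 2" if "t \<in> {a..b}" for t
    using tendstoD[OF lim[OF that], of "e / 2"] e by (simp add: dist_real_def)
  have "\<forall>\<^sub>F n in sequentially. \<forall>c\<in>C. \<bar>F n (?l c) - g (?l c)\<bar> < e / 2 \<and> \<bar>F n (?u c) - g (?u c)\<bar> < e / 2"
    using C(1,2) d(1) by (intro eventually_ball_finite eventually_conj ballI ev) auto
  then show "\<forall>\<^sub>F n in sequentially. \<forall>t\<in>{a..b}. dist (F n t) (g t) < e"
  proof eventually_elim
    case (elim n)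
    show ?case
    proof
      fix t assume t: "t \<in> {a..b}"
      with C(3) obtain c where c: "c \<in> C" "\<bar>c - t\<bar> < d / 2"
        by (auto simp: dist_real_def)
      then have c': "c - t < d / 2" "t - c < d / 2" by linarith+
      have cab: "c \<in> {a..b}" using C(2) c(1) by auto
      have l: "?l c \<in> {a..b}" "?l c \<le> t" "\<bar>?l c - t\<bar> < d"
        and u: "?u c \<in> {a..b}" "t \<le> ?u c" "\<bar>?u c - t\<bar> < d"
        using c' t cab d(1) by (auto simp: max_def min_def abs_less_iff)
      have "F n (?l c) \<le> F n t" "F n t \<le> F n (?u c)"
        by (rule mono_onD[OF mono l(1) t l(2)], rule mono_onD[OF mono t u(1,2)])
      moreover have "\<bar>g (?l c) - g t\<bar> < e / 2" "\<bar>g (?u c) - g t\<bar> < e / 2"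
        using d(2) l u t by auto
      moreover have "\<bar>F n (?l c) - g (?l c)\<bar> < e / 2" "\<bar>F n (?u c) - g (?u c)\<bar> < e / 2"
        using elim c(1) by auto
      ultimately show "dist (F n t) (g t) < e"
        unfolding dist_real_def by linarith
    qed
  qed
qed

text \<open>The push-forward to the whole line turns a measure on \<open>[0,T]\<close> into a
  \<open>finite_borel_measure\<close>, so that the continuity and uniqueness results for
  \<open>cdf\<close> apply.\<close>

abbreviation cdf_on :: "real measure \<Rightarrow> real \<Rightarrow> real" where
  "cdf_on M \<equiv> cdf (distr M borel (\<lambda>s. s))"

locale measure_on_interval = finite_measure M for M :: "real measure" and T :: real +
  assumes sets_M: "sets M = sets (restrict_space borel {0..T})"
begin

lemma space_M: "space M = {0..T}"
  using sets_eq_imp_space_eq[OF sets_M] by (simp add: space_restrict_space)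

lemma id_measurable: "(\<lambda>s. s) \<in> measurable M borel"
  using sets_M by (simp cong: measurable_cong_sets add: measurable_restrict_space1)

lemma finite_borel_measure_distr: "finite_borel_measure (distr M borel (\<lambda>s. s))"
  using finite_measure_distr[OF id_measurable]
  by (simp add: finite_borel_measure_def finite_borel_measure_axioms_def)

lemma sets_MI: "A \<in> sets borel \<Longrightarrow> A \<subseteq> {0..T} \<Longrightarrow> A \<in> sets M"
  by (simp add: sets_M sets_restrict_space_iff)

lemma measure_distr_id: "A \<in> sets borel \<Longrightarrow> measure (distr M borel (\<lambda>s. s)) A = measure M (A \<inter> {0..T})"
  using id_measurable by (simp add: measure_distr space_M)

lemma cdf_on_eq: "t \<le> T \<Longrightarrow> cdf_on M t = measure M {0..t}"
  by (auto simp: cdf_def measure_distr_id intro!: arg_cong[where f="measure M"])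

lemma cdf_on_below: "t < 0 \<Longrightarrow> cdf_on M t = 0"
  by (subst cdf_def, subst measure_distr_id) auto

lemma cdf_on_above: "T \<le> t \<Longrightarrow> cdf_on M t = measure M {0..T}"
  by (auto simp: cdf_def measure_distr_id intro!: arg_cong[where f="measure M"])

text \<open>A point of positive mass would be an atom, its only subsets being itself and the empty
  set; and \<open>cdf\<close> is continuous exactly at points without mass.\<close>

lemma nonatomic_isCont_cdf_on:
  assumes "nonatomic M"
  shows "isCont (cdf_on M) t"
proof -
  have "measure M ({t} \<inter> {0..T}) = 0"
  proof (cases "t \<in> {0..T}")
    case True
    have "{t} \<in> sets M"
      using True by (intro sets_MI) auto
    moreover have "emeasure M B = 0 \<or> emeasure M B = emeasure M {t}" if "B \<subseteq> {t}" for B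
      using that by (cases "B = {}") (auto simp: subset_singleton_iff)
    ultimately have "emeasure M {t} = 0"
      using assms unfolding nonatomic_def by (metis zero_less_iff_neq_zero)
    then show ?thesis
      using True by (simp add: measure_def)
  qed simp
  then show ?thesis
    by (simp add: finite_borel_measure.isCont_cdf[OF finite_borel_measure_distr] measure_distr_id)
qed

text \<open>The ramp is 1 up to \<open>a\<close> and 0 from \<open>b\<close> on, so it lies between
  the indicators of \<open>{..a}\<close> and \<open>{..b}\<close>. It is the continuous test
  function through which weak convergence controls distribution functions.\<close>

lemma ramp_bounds:
  assumes "a < b"
  defines "f \<equiv> \<lambda>s. max 0 (min 1 ((b - s) / (b - a)))"
  shows "cdf_on M a \<le> integral\<^sup>L M f" "integral\<^sup>L M f \<le> cdf_on M b"
proof -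
  let ?N = "distr M borel (\<lambda>s. s)"
  interpret N: finite_borel_measure ?N
    by (rule finite_borel_measure_distr)
  have f[measurable]: "f \<in> borel_measurable borel"
    unfolding f_def by measurable
  have eq: "integral\<^sup>L M f = integral\<^sup>L ?N f"
    using id_measurable by (simp add: integral_distr)
  have int: "integrable ?N f"
    by (rule N.integrable_const_bound[where B=1]) (auto simp: f_def)
  have *: "integrable ?N (indicator {..c} :: real \<Rightarrow> real)" for c
    by (rule N.integrable_const_bound[where B=1]) auto
  have "cdf_on M a = integral\<^sup>L ?N (indicator {..a})" by (simp add: cdf_def)
  also have "\<dots> \<le> integral\<^sup>L ?N f"
    using assms(1) by (intro integral_mono * int) (auto simp: f_def indicator_def)
  finally show "cdf_on M a \<le> integral\<^sup>L M f" by (simp add: eq)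
  have "integral\<^sup>L ?N f \<le> integral\<^sup>L ?N (indicator {..b})"
    using assms(1) by (intro integral_mono * int) (auto simp: f_def indicator_def divide_simps)
  also have "\<dots> = cdf_on M b" by (simp add: cdf_def)
  finally show "integral\<^sup>L M f \<le> cdf_on M b" by (simp add: eq)
qed

lemma continuous_integrable:
  fixes f :: "real \<Rightarrow> real"
  assumes "continuous_on {0..T} f"
  shows "integrable M f"
proof -
  have "f \<in> borel_measurable M"
    using borel_measurable_continuous_on_restrict[OF assms] sets_M
    by (simp cong: measurable_cong_sets)
  moreover obtain B where "\<And>s. s \<in> {0..T} \<Longrightarrow> \<bar>f s\<bar> \<le> B"
    using compact_imp_bounded[OF compact_continuous_image[OF assms compact_Icc]]
    unfolding bounded_iff by (metis imageI real_norm_def)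
  ultimately show ?thesis
    by (intro integrable_const_bound[where B=B]) (auto simp: space_M)
qed

text \<open>\<open>f\<close> is replaced by the step function with value \<open>f (a j)\<close>
  between \<open>a (j - 1)\<close> and \<open>a j\<close>, whose integral depends on
  \<open>M\<close> only through masses of intervals starting at 0. The premise \<open>approx\<close>
  concerns the pairs where \<open>j\<close> is the first index with
  \<open>s \<le> a j\<close>.\<close>

lemma integral_step_approx:
  fixes f :: "real \<Rightarrow> real" and a :: "nat \<Rightarrow> real"
  assumes f: "continuous_on {0..T} f"
    and a: "\<And>j. j \<le> K \<Longrightarrow> a j \<in> {0..T}" "\<And>i j. i \<le> j \<Longrightarrow> j \<le> K \<Longrightarrow> a i \<le> a j" "a K = T"
    and approx: "\<And>s j. s \<in> {0..T} \<Longrightarrow> j \<le> K \<Longrightarrow> s \<le> a j \<Longrightarrow> (\<And>i. i < j \<Longrightarrow> a i < s) \<Longrightarrow> \<bar>f s - f (a j)\<bar> \<le> e"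
  shows "\<bar>integral\<^sup>L M f - (f T * measure M {0..T} + (\<Sum>j<K. (f (a j) - f (a (Suc j))) * measure M {0..a j}))\<bar>
    \<le> e * measure M {0..T}"
proof -
  \<comment> \<open>By Abel summation, \<open>?g s\<close> is \<open>f\<close> at the first grid point not below \<open>s\<close>.\<close>
  let ?g = "\<lambda>s. f T * indicator {0..T} s + (\<Sum>j<K. (f (a j) - f (a (Suc j))) * indicator {0..a j} s)"
  have sets: "{0..a j} \<in> sets M" if "j \<le> K" for j
    using a(1)[OF that] by (intro sets_MI) auto
  have TM: "{0..T} \<in> sets M"
    by (intro sets_MI) auto
  have intT: "integrable M (\<lambda>s. indicator {0..T} s :: real)"
    using TM by (simp add: less_top[symmetric])
  have inta: "integrable M (\<lambda>s. (\<Sum>j<K. (f (a j) - f (a (Suc j))) * indicator {0..a j} s))"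
    using sets by (intro Bochner_Integration.integrable_sum integrable_mult_right) (simp add: less_top[symmetric])
  have gint: "integrable M ?g"
    using intT inta by (intro Bochner_Integration.integrable_add integrable_mult_right)
  have int: "integrable M (\<lambda>s. f s - ?g s)"
    using continuous_integrable[OF f] gint by (rule Bochner_Integration.integrable_diff)
  have ge: "integral\<^sup>L M ?g = f T * measure M {0..T} + (\<Sum>j<K. (f (a j) - f (a (Suc j))) * measure M {0..a j})"
  proof -
    have "integral\<^sup>L M ?g = integral\<^sup>L M (\<lambda>s. f T * indicator {0..T} s)
        + integral\<^sup>L M (\<lambda>s. \<Sum>j<K. (f (a j) - f (a (Suc j))) * indicator {0..a j} s)"
      using intT inta by (intro Bochner_Integration.integral_add integrable_mult_right)
    also have "integral\<^sup>L M (\<lambda>s. \<Sum>j<K. (f (a j) - f (a (Suc j))) * indicator {0..a j} s)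
        = (\<Sum>j<K. integral\<^sup>L M (\<lambda>s. (f (a j) - f (a (Suc j))) * indicator {0..a j} s))"
      using sets by (intro Bochner_Integration.integral_sum integrable_mult_right) (simp add: less_top[symmetric])
    also have "\<dots> = (\<Sum>j<K. (f (a j) - f (a (Suc j))) * measure M {0..a j})"
      using a(1) by (intro sum.cong refl) (simp add: Int_absorb2 space_M)
    finally show ?thesis
      using TM by (simp add: space_M)
  qed
  have bound: "\<bar>f s - ?g s\<bar> \<le> e" if s: "s \<in> {0..T}" for s
  proof -
    define m where "m = (LEAST j. s \<le> a j)"
    have sK: "s \<le> a K" using s a(3) by simp
    have m: "s \<le> a m" "m \<le> K"
      unfolding m_def by (rule LeastI[of "\<lambda>j. s \<le> a j", OF sK]) (rule Least_le[of "\<lambda>j. s \<le> a j", OF sK])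
    have less: "a i < s" if "i < m" for i
      using not_less_Least[of i] that unfolding m_def by force
    \<comment> \<open>Indices below \<open>m\<close> have \<open>a j < s\<close> and drop out; the
      remaining differences telescope to \<open>f (a m) - f T\<close>.\<close>
    have "(\<Sum>j<K. (f (a j) - f (a (Suc j))) * indicator {0..a j} s) = (\<Sum>j=m..<K. f (a j) - f (a (Suc j)))"
    proof (rule sum.mono_neutral_cong_right)
      show "\<forall>j\<in>{..<K} - {m..<K}. (f (a j) - f (a (Suc j))) * indicator {0..a j} s = 0"
        using less by (auto simp: indicator_def not_le)
      fix j assume "j \<in> {m..<K}"
      then have "s \<le> a j" using m a(2)[of m j] by auto
      then show "(f (a j) - f (a (Suc j))) * indicator {0..a j} s = f (a j) - f (a (Suc j))"
        using s by simp
    qed auto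
    also have "\<dots> = f (a m) - f T"
      using sum_Suc_diff'[of m K "\<lambda>j. - f (a j)"] m(2) a(3) by simp
    finally have "?g s = f (a m)" using s by simp
    then show ?thesis using approx[OF s m(2,1) less] by simp
  qed
  have "\<bar>integral\<^sup>L M f - integral\<^sup>L M ?g\<bar> = \<bar>integral\<^sup>L M (\<lambda>s. f s - ?g s)\<bar>"
    using continuous_integrable[OF f] gint by (subst Bochner_Integration.integral_diff) auto
  also have "\<dots> \<le> integral\<^sup>L M (\<lambda>s. \<bar>f s - ?g s\<bar>)"
    by (rule integral_abs_bound)
  also have "\<dots> \<le> integral\<^sup>L M (\<lambda>s. e)"
    using int bound by (intro integral_mono) (auto simp: space_M)
  finally show ?thesis unfolding ge by (simp add: space_M mult.commute)
qed

end

text \<open>Equal masses of \<open>{0..t}\<close> give equal distribution functions and hence equal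
  push-forwards, from which the mass of every Borel subset of \<open>[0,T]\<close> is read
  off.\<close>

lemma measure_on_interval_eqI:
  assumes "measure_on_interval \<mu> T" "measure_on_interval \<nu> T"
    and eq: "\<And>t. t \<in> {0..T} \<Longrightarrow> measure \<mu> {0..t} = measure \<nu> {0..t}"
  shows "\<mu> = \<nu>"
proof (rule measure_eqI)
  interpret \<mu>: measure_on_interval \<mu> T by fact
  interpret \<nu>: measure_on_interval \<nu> T by fact
  show "sets \<mu> = sets \<nu>" by (simp add: \<mu>.sets_M \<nu>.sets_M)
  have "cdf_on \<mu> t = cdf_on \<nu> t" for t
  \<comment> \<open>When \<open>T < 0\<close> there is no \<open>t\<close> to which
    \<open>eq\<close> applies, but the intervals whose masses are compared are empty.\<close>
  proof (cases "T < 0")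
    case True
    then show ?thesis by (cases "t \<le> T") (auto simp: \<mu>.cdf_on_eq \<nu>.cdf_on_eq \<mu>.cdf_on_above \<nu>.cdf_on_above)
  next
    case False
    then show ?thesis using eq[of T] eq[of t]
      by (cases "t < 0"; cases "t \<le> T")
         (auto simp: \<mu>.cdf_on_eq \<nu>.cdf_on_eq \<mu>.cdf_on_above \<nu>.cdf_on_above \<mu>.cdf_on_below \<nu>.cdf_on_below)
  qed
  then have D: "distr \<mu> borel (\<lambda>s. s) = distr \<nu> borel (\<lambda>s. s)"
    by (intro cdf_unique' \<mu>.finite_borel_measure_distr \<nu>.finite_borel_measure_distr) auto
  fix A assume "A \<in> sets \<mu>"
  then have A: "A \<in> sets borel" "A \<subseteq> {0..T}"
    by (auto simp: \<mu>.sets_M sets_restrict_space_iff)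
  have "measure \<mu> A = measure \<nu> A"
    using \<mu>.measure_distr_id[OF A(1)] \<nu>.measure_distr_id[OF A(1)] D A(2)
    by (simp add: Int_absorb2)
  then show "emeasure \<mu> A = emeasure \<nu> A"
    by (simp add: \<mu>.emeasure_eq_measure \<nu>.emeasure_eq_measure)
qed

text \<open>If \<open>y\<close> lies below the limit, left continuity leaves room for a ramp
  descending from some \<open>s < t\<close> to \<open>t\<close> whose \<open>\<mu>\<close>-integral
  exceeds \<open>y\<close>; weak convergence hands this to \<open>M n\<close>, where the ramp bounds
  \<open>cdf_on (M n) t\<close> from below. For \<open>y\<close> above the limit the ramp descends
  from \<open>t\<close> to some \<open>s > t\<close>.\<close>

lemma weakly_converges_on_imp_cdf_tendsto:
  assumes M: "\<And>n. measure_on_interval (M n) T" and \<mu>: "measure_on_interval \<mu> T"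
    and cont: "isCont (cdf_on \<mu>) t" and weak: "weakly_converges_on T M \<mu>"
  shows "(\<lambda>n. cdf_on (M n) t) \<longlonglongrightarrow> cdf_on \<mu> t"
proof -
  let ?f = "\<lambda>a b s. max 0 (min 1 ((b - s) / (b - a))) :: real"
  have lim: "(\<lambda>n. integral\<^sup>L (M n) (?f a b)) \<longlonglongrightarrow> integral\<^sup>L \<mu> (?f a b)" if "a < b" for a b
  proof -
    have "continuous_on {0..T} (?f a b)"
      using that by (intro continuous_intros) auto
    then show ?thesis
      using weak by (simp only: weakly_converges_on_def)
  qed
  have left: "(cdf_on \<mu> \<longlongrightarrow> cdf_on \<mu> t) (at_left t)" and right: "(cdf_on \<mu> \<longlongrightarrow> cdf_on \<mu> t) (at_right t)"
    using cont unfolding isCont_def filterlim_at_split by (rule conjunct1, rule conjunct2)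
  show ?thesis
  proof (rule order_tendstoI)
    fix y assume "y < cdf_on \<mu> t"
    from order_tendstoD(1)[OF left this] eventually_at_left_real[of "t - 1" t, simplified]
    have "\<forall>\<^sub>F s in at_left t. s < t \<and> y < cdf_on \<mu> s"
      by eventually_elim simp
    from eventually_happens'[OF trivial_limit_at_left_real this]
    obtain s where s: "s < t" "y < cdf_on \<mu> s" by blast
    have "y < integral\<^sup>L \<mu> (?f s t)"
      using s(2) measure_on_interval.ramp_bounds(1)[OF \<mu> s(1)] by (rule order_less_le_trans)
    from order_tendstoD(1)[OF lim[OF s(1)] this]
    show "\<forall>\<^sub>F n in sequentially. y < cdf_on (M n) t"
      by (rule eventually_mono) (rule order_less_le_trans[OF _ measure_on_interval.ramp_bounds(2)[OF M s(1)]])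
  next
    fix y assume "cdf_on \<mu> t < y"
    from order_tendstoD(2)[OF right this] eventually_at_right_less[of t]
    have "\<forall>\<^sub>F s in at_right t. t < s \<and> cdf_on \<mu> s < y"
      by eventually_elim simp
    from eventually_happens'[OF trivial_limit_at_right_real this]
    obtain s where s: "t < s" "cdf_on \<mu> s < y" by blast
    have "integral\<^sup>L \<mu> (?f t s) < y"
      using measure_on_interval.ramp_bounds(2)[OF \<mu> s(1)] s(2) by (rule order_le_less_trans)
    from order_tendstoD(2)[OF lim[OF s(1)] this]
    show "\<forall>\<^sub>F n in sequentially. cdf_on (M n) t < y"
      by (rule eventually_mono) (rule order_le_less_trans[OF measure_on_interval.ramp_bounds(1)[OF M s(1)]])
  qed
qed

text \<open>The step approximation of the integral involves finitely many masses, all of which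
  converge, and its error is uniform in large \<open>n\<close> because the total masses are
  eventually bounded.\<close>

lemma weakly_converges_onI:
  assumes "0 < T" and M: "\<And>n. measure_on_interval (M n) T" and \<mu>: "measure_on_interval \<mu> T"
    and lim: "\<And>t. t \<in> {0..T} \<Longrightarrow> (\<lambda>n. measure (M n) {0..t}) \<longlonglongrightarrow> measure \<mu> {0..t}"
  shows "weakly_converges_on T M \<mu>"
  unfolding weakly_converges_on_def
proof (intro allI impI)
  fix f :: "real \<Rightarrow> real" assume f: "continuous_on {0..T} f"
  show "(\<lambda>n. integral\<^sup>L (M n) f) \<longlonglongrightarrow> integral\<^sup>L \<mu> f"
  proof (rule tendstoI)
    fix \<epsilon> :: real assume \<epsilon>: "0 < \<epsilon>"
    \<comment> \<open>One more than the limiting total mass, hence a bound for the total mass of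
      \<open>M n\<close> for all large \<open>n\<close>.\<close>
    define L where "L = measure \<mu> {0..T} + 1"
    have L: "L > 0" by (simp add: L_def add_nonneg_pos)
    \<comment> \<open>The two step approximations cost at most \<open>e * L = \<epsilon> / 4\<close>
      each, which leaves \<open>\<epsilon> / 2\<close> for the convergence of the step sums.\<close>
    define e where "e = \<epsilon> / (4 * L)"
    have e: "e > 0" using \<epsilon> L by (simp add: e_def)
    have "uniformly_continuous_on {0..T} f"
      using f by (simp add: compact_uniformly_continuous)
    then obtain d where d: "d > 0"
      "\<And>s t. s \<in> {0..T} \<Longrightarrow> t \<in> {0..T} \<Longrightarrow> \<bar>t - s\<bar> < d \<Longrightarrow> \<bar>f t - f s\<bar> < e"
      using e unfolding uniformly_continuous_on_def dist_real_def by meson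
    obtain K :: nat where K: "T / d < K" using reals_Archimedean2 by blast
    have K0: "0 < K" using K d \<open>0 < T\<close> by (smt (verit) divide_pos_pos of_nat_0_less_iff)
    define a where "a j = real j * (T / K)" for j
    have TK: "T / K < d" "0 < T / K"
      using K d(1) K0 \<open>0 < T\<close> by (auto simp: field_simps)
    have a: "a j \<in> {0..T}" if "j \<le> K" for j
      using that K0 \<open>0 < T\<close> mult_right_mono[of "real j" "real K" "T"] by (auto simp: a_def field_simps)
    have amono: "a i \<le> a j" if "i \<le> j" "j \<le> K" for i j
      using that TK(2) unfolding a_def by (intro mult_right_mono) auto
    have aK: "a K = T" using K0 by (simp add: a_def)
    have approx: "\<bar>f s - f (a j)\<bar> \<le> e"
      if s: "s \<in> {0..T}" "j \<le> K" "s \<le> a j" and less: "\<And>i. i < j \<Longrightarrow> a i < s" for s j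
    proof -
      have "a j - s < d"
      \<comment> \<open>For \<open>j = 0\<close> only \<open>s = 0 = a 0\<close> is possible;
        otherwise \<open>s\<close> lies above the preceding grid point, one spacing
        \<open>T / K < d\<close> below \<open>a j\<close>.\<close>
      proof (cases j)
        case 0
        then show ?thesis using s d(1) by (simp add: a_def)
      next
        case (Suc i)
        then have "a i < s" using less by simp
        moreover have "a j = a i + T / K"
          unfolding a_def Suc of_nat_Suc by (simp only: distrib_right)
        ultimately show ?thesis using TK(1) by linarith
      qed
      then show ?thesis using d(2)[OF a[OF s(2)] s(1)] s(3) by fastforce
    qed
    let ?S = "\<lambda>N. f T * measure N {0..T} + (\<Sum>j<K. (f (a j) - f (a (Suc j))) * measure N {0..a j})"
    have err: "\<bar>integral\<^sup>L N f - ?S N\<bar> \<le> e * measure N {0..T}" if "measure_on_interval N T" for N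
      using f a amono aK approx by (rule measure_on_interval.integral_step_approx[OF that])
    have "(\<lambda>n. ?S (M n)) \<longlonglongrightarrow> ?S \<mu>"
      using \<open>0 < T\<close> by (intro tendsto_intros lim a) auto
    then have "\<forall>\<^sub>F n in sequentially. \<bar>?S (M n) - ?S \<mu>\<bar> < \<epsilon> / 2"
      unfolding dist_real_def[symmetric] using \<epsilon> by (intro tendstoD) auto
    moreover have "\<forall>\<^sub>F n in sequentially. measure (M n) {0..T} < L"
      using lim[of T] \<open>0 < T\<close> by (intro order_tendstoD) (auto simp: L_def)
    ultimately show "\<forall>\<^sub>F n in sequentially. dist (integral\<^sup>L (M n) f) (integral\<^sup>L \<mu> f) < \<epsilon>"
    proof eventually_elim
      case (elim n)
      have "e * measure (M n) {0..T} \<le> e * L" "e * measure \<mu> {0..T} \<le> e * L"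
        using elim(2) e by (auto simp: L_def)
      moreover have "e * L = \<epsilon> / 4"
        using L by (simp add: e_def)
      ultimately have "\<bar>integral\<^sup>L (M n) f - ?S (M n)\<bar> \<le> \<epsilon> / 4" "\<bar>integral\<^sup>L \<mu> f - ?S \<mu>\<bar> \<le> \<epsilon> / 4"
        using err[OF M[of n]] err[OF \<mu>] by linarith+
      with elim(1) \<epsilon> show ?case
        unfolding dist_real_def by linarith
    qed
  qed
qed

subsection \<open>Stopped \<open>p\<close>-variation\<close>

lemma partition_points:
  assumes "0 < T" "is_partition T us"
  shows "num_intervals us > 0" "us ! 0 = 0" "us ! num_intervals us = T"
    "\<And>i j. i < j \<Longrightarrow> j \<le> num_intervals us \<Longrightarrow> us ! i < us ! j"
    "\<And>i j. i \<le> j \<Longrightarrow> j \<le> num_intervals us \<Longrightarrow> us ! i \<le> us ! j"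
    "\<And>i. i \<le> num_intervals us \<Longrightarrow> us ! i \<in> {0..T}"
proof -
  have us: "us \<noteq> []" "hd us = 0" "last us = T" "sorted_wrt (<) us"
    using assms(2) by (auto simp: is_partition_def)
  show "us ! 0 = 0" "us ! num_intervals us = T"
    using us by (auto simp: hd_conv_nth last_conv_nth num_intervals_def)
  then show "num_intervals us > 0"
    using assms(1) by (cases "num_intervals us") auto
  show lt: "us ! i < us ! j" if "i < j" "j \<le> num_intervals us" for i j
    using us(1) that by (intro sorted_wrt_nth_less[OF us(4)]) (cases us, auto simp: num_intervals_def)
  show "us ! i \<le> us ! j" if "i \<le> j" "j \<le> num_intervals us" for i j
    using lt[of i j] that by (cases "i = j") auto
  show "us ! i \<in> {0..T}" if "i \<le> num_intervals us" for i
    using that us(1) by (intro partition_nth_mem[OF assms(2)]) (cases us, auto simp: num_intervals_def)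
qed

lemma mesh_ge: "i < num_intervals us \<Longrightarrow> us ! Suc i - us ! i \<le> mesh us"
  unfolding mesh_def by (intro Max_ge) auto

lemma mesh_pos:
  assumes "0 < T" "is_partition T us"
  shows "0 < mesh us"
  using mesh_ge[of 0 us] partition_points(1)[OF assms] partition_points(4)[OF assms, of 0 1] by auto

text \<open>A real \<open>Sup\<close> is an upper bound only of a set that is bounded above; here
  compactness of \<open>[0,T]\<close> supplies the bound.\<close>

lemma osc_bound:
  assumes "continuous_on {0..T} x" "s \<in> {0..T}" "t \<in> {0..T}" "\<bar>t - s\<bar> \<le> h"
  shows "\<bar>x t - x s\<bar> \<le> osc T x h"
proof -
  obtain B where B: "\<forall>y\<in>x ` {0..T}. \<bar>y\<bar> \<le> B"
    using compact_imp_bounded[OF compact_continuous_image[OF assms(1) compact_Icc]]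
    unfolding bounded_iff real_norm_def by auto
  have "bdd_above {\<bar>x t - x s\<bar> | s t. s \<in> {0..T} \<and> t \<in> {0..T} \<and> \<bar>t - s\<bar> \<le> h}"
  proof (rule bdd_aboveI)
    fix y assume "y \<in> {\<bar>x t - x s\<bar> | s t. s \<in> {0..T} \<and> t \<in> {0..T} \<and> \<bar>t - s\<bar> \<le> h}"
    then obtain s t where y: "y = \<bar>x t - x s\<bar>" "s \<in> {0..T}" "t \<in> {0..T}" by auto
    then have "\<bar>x s\<bar> \<le> B" "\<bar>x t\<bar> \<le> B" using B by auto
    then show "y \<le> 2 * B" unfolding y(1) by linarith
  qed
  then show ?thesis
    unfolding osc_def using assms(2-4) by (intro cSup_upper) auto
qed

lemma osc_nonneg:
  assumes "0 \<le> T" "continuous_on {0..T} x" "0 \<le> h"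
  shows "0 \<le> osc T x h"
  using osc_bound[of T x 0 0 h] assms by simp

lemma osc_tendsto_0:
  assumes "0 \<le> T" "continuous_on {0..T} x" "\<And>n. 0 \<le> h n" "h \<longlonglongrightarrow> 0"
  shows "(\<lambda>n. osc T x (h n)) \<longlonglongrightarrow> 0"
proof (rule tendstoI)
  fix e :: real assume e: "0 < e"
  have "uniformly_continuous_on {0..T} x"
    using assms(2) by (simp add: compact_uniformly_continuous)
  then obtain d where d: "d > 0"
    "\<And>s t. s \<in> {0..T} \<Longrightarrow> t \<in> {0..T} \<Longrightarrow> \<bar>t - s\<bar> < d \<Longrightarrow> \<bar>x t - x s\<bar> < e / 2"
    using half_gt_zero[OF e] unfolding dist_real_def by (rule uniformly_continuous_onE) (auto simp: dist_real_def)
  have "\<forall>\<^sub>F n in sequentially. h n < d"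
    using order_tendstoD(2)[OF assms(4) d(1)] .
  then show "\<forall>\<^sub>F n in sequentially. dist (osc T x (h n)) 0 < e"
  proof eventually_elim
    case (elim n)
    \<comment> \<open>Strict bounds on increments survive the supremum only as weak ones, hence the
      target \<open>e / 2\<close>. The pair \<open>s = t = 0\<close> makes the set nonempty.\<close>
    have "osc T x (h n) \<le> e / 2"
      unfolding osc_def
    proof (rule cSup_least)
      have "\<bar>x 0 - x 0\<bar> \<in> {\<bar>x t - x s\<bar> |s t. s \<in> {0..T} \<and> t \<in> {0..T} \<and> \<bar>t - s\<bar> \<le> h n}"
        using assms(1,3) by fastforce
      then show "{\<bar>x t - x s\<bar> |s t. s \<in> {0..T} \<and> t \<in> {0..T} \<and> \<bar>t - s\<bar> \<le> h n} \<noteq> {}"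
        by blast
    next
      fix y assume "y \<in> {\<bar>x t - x s\<bar> |s t. s \<in> {0..T} \<and> t \<in> {0..T} \<and> \<bar>t - s\<bar> \<le> h n}"
      then show "y \<le> e / 2" using d(2) elim by (force intro: less_imp_le)
    qed
    then show ?case
      using osc_nonneg[OF assms(1,2,3), of n] e by simp
  qed
qed

text \<open>This truncates the increment straddling \<open>t\<close>, whereas the mass of
  \<open>{0..t}\<close> under \<open>variation_measure\<close> counts it in full. It is the
  fine-scale sum in \<open>coarse_graining_error\<close>.\<close>

definition stopped_var :: "real \<Rightarrow> real list \<Rightarrow> (real \<Rightarrow> real) \<Rightarrow> real \<Rightarrow> real" where
  "stopped_var p us x t = (\<Sum>j<num_intervals us. \<bar>stopped_incr us x j t\<bar> powr p)"

lemma measure_on_interval_variation_measure: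
  assumes "is_partition T us"
  shows "measure_on_interval (variation_measure T p x us) T"
proof -
  let ?P = "point_measure {..<num_intervals us} (\<lambda>i. ennreal (\<bar>x (us ! Suc i) - x (us ! i)\<bar> powr p))"
  have "\<And>i. i < num_intervals us \<Longrightarrow> us ! i \<in> {0..T}"
    by (rule partition_nth_mem[OF assms]) (simp add: num_intervals_def)
  then have u: "(\<lambda>i. us ! i) \<in> measurable ?P (restrict_space borel {0..T})"
    by (auto simp: measurable_point_measure_eq1 space_restrict_space)
  have "finite_measure ?P"
    by (intro finite_measureI) (simp add: emeasure_point_measure_finite space_point_measure)
  then have "finite_measure (variation_measure T p x us)"
    unfolding variation_measure_def using u by (rule finite_measure.finite_measure_distr)
  then show ?thesis
    by (simp add: measure_on_interval_def measure_on_interval_axioms_def variation_measure_def)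
qed

lemma measure_variation_measure:
  assumes "is_partition T us" "t \<in> {0..T}"
  shows "measure (variation_measure T p x us) {0..t} =
    (\<Sum>i<num_intervals us. if us ! i \<le> t then \<bar>x (us ! Suc i) - x (us ! i)\<bar> powr p else 0)"
proof -
  let ?w = "\<lambda>i. \<bar>x (us ! Suc i) - x (us ! i)\<bar> powr p"
  let ?P = "point_measure {..<num_intervals us} (\<lambda>i. ennreal (?w i))"
  have mem: "\<And>i. i < num_intervals us \<Longrightarrow> us ! i \<in> {0..T}"
    by (rule partition_nth_mem[OF assms(1)]) (simp add: num_intervals_def)
  then have u: "(\<lambda>i. us ! i) \<in> measurable ?P (restrict_space borel {0..T})"
    by (auto simp: measurable_point_measure_eq1 space_restrict_space)
  have "{0..t} \<in> sets (restrict_space borel {0..T})"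
    using assms(2) by (auto simp: sets_restrict_space_iff)
  then have "measure (variation_measure T p x us) {0..t} = measure ?P ((\<lambda>i. us ! i) -` {0..t} \<inter> {..<num_intervals us})"
    unfolding variation_measure_def by (subst measure_distr[OF u]) (auto simp: space_point_measure)
  also have "\<dots> = sum ?w ((\<lambda>i. us ! i) -` {0..t} \<inter> {..<num_intervals us})"
    by (simp add: measure_def emeasure_point_measure_finite sum_nonneg)
  also have "\<dots> = (\<Sum>i<num_intervals us. if us ! i \<le> t then ?w i else 0)"
    using mem by (intro sum.mono_neutral_cong_left) auto
  finally show ?thesis .
qed

text \<open>Intervals ending by \<open>t\<close> are unaffected by stopping and intervals starting
  after \<open>t\<close> contribute 0 to both sides, so only the interval containing
  \<open>t\<close> in its half-open form \<open>S\<close> matters.\<close>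

lemma stopped_var_close:
  assumes "0 < T" "is_partition T us" "continuous_on {0..T} x" "t \<in> {0..T}" "0 \<le> p"
  shows "\<bar>measure (variation_measure T p x us) {0..t} - stopped_var p us x t\<bar> \<le> osc T x (mesh us) powr p"
proof -
  note P = partition_points[OF assms(1,2)]
  define N where "N = num_intervals us"
  define g where "g i = (if us ! i \<le> t then \<bar>x (us ! Suc i) - x (us ! i)\<bar> powr p else 0)
    - \<bar>stopped_incr us x i t\<bar> powr p" for i
  define S where "S = {i. i < N \<and> us ! i \<le> t \<and> t < us ! Suc i}"
  have S: "finite S" by (simp add: S_def)
  have "i = j" if "i \<in> S" "j \<in> S" for i j
  proof (rule ccontr)
    assume "i \<noteq> j"
    then consider "Suc i \<le> j" | "Suc j \<le> i" by linarith
    then show False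
      using that P(5)[of "Suc i" j] P(5)[of "Suc j" i] by cases (auto simp: S_def N_def)
  qed
  then have card: "card S \<le> 1"
    using S by (auto simp: card_le_Suc0_iff_eq)
  have zero: "g i = 0" if "i < N" "i \<notin> S" for i
  proof -
    have "us ! i \<le> us ! Suc i" using that P(5)[of i "Suc i"] by (simp add: N_def)
    then show ?thesis
      using that by (auto simp: S_def g_def stopped_incr_def min_def)
  qed
  have le: "\<bar>g i\<bar> \<le> osc T x (mesh us) powr p" if "i \<in> S" for i
  proof -
    have i: "i < N" "us ! i \<le> t" "t < us ! Suc i" using that by (auto simp: S_def)
    have m: "us ! i \<in> {0..T}" "us ! Suc i \<in> {0..T}" using i P(6) by (auto simp: N_def)
    have h: "us ! Suc i - us ! i \<le> mesh us" using i mesh_ge by (simp add: N_def)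
    have "\<bar>x (us ! Suc i) - x (us ! i)\<bar> \<le> osc T x (mesh us)" "\<bar>x t - x (us ! i)\<bar> \<le> osc T x (mesh us)"
      using h i m assms(3,4) by (auto intro!: osc_bound)
    then have "\<bar>x (us ! Suc i) - x (us ! i)\<bar> powr p \<le> osc T x (mesh us) powr p"
      "\<bar>x t - x (us ! i)\<bar> powr p \<le> osc T x (mesh us) powr p"
      using assms(5) by (auto intro!: powr_mono2)
    moreover have "g i = \<bar>x (us ! Suc i) - x (us ! i)\<bar> powr p - \<bar>x t - x (us ! i)\<bar> powr p"
      using i by (simp add: g_def stopped_incr_def min_def)
    \<comment> \<open>Both powers lie between 0 and \<open>osc T x (mesh us) powr p\<close>, so
      their difference costs one such term and not two.\<close>
    moreover have "0 \<le> \<bar>x (us ! Suc i) - x (us ! i)\<bar> powr p" "0 \<le> \<bar>x t - x (us ! i)\<bar> powr p" by auto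
    ultimately show ?thesis by linarith
  qed
  have "measure (variation_measure T p x us) {0..t} - stopped_var p us x t = (\<Sum>i<N. g i)"
    by (simp add: measure_variation_measure[OF assms(2,4)] stopped_var_def g_def N_def sum_subtractf)
  also have "\<dots> = sum g S"
    using zero by (intro sum.mono_neutral_right) (auto simp: S_def)
  also have "\<bar>\<dots>\<bar> \<le> (\<Sum>i\<in>S. \<bar>g i\<bar>)" by (rule sum_abs)
  also have "\<dots> \<le> real (card S) * osc T x (mesh us) powr p"
    using le by (intro sum_bounded_above) auto
  also have "\<dots> \<le> 1 * osc T x (mesh us) powr p"
    using card by (intro mult_right_mono) auto
  finally show ?thesis by simp
qed

section \<open>Variation limits in terms of distribution functions\<close>

lemma osc_mesh_powr_tendsto_0:
  assumes "0 < T" "0 < p" "continuous_on {0..T} x" "vanishing_partitions T \<sigma>"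
  shows "(\<lambda>n. osc T x (mesh (\<sigma> n)) powr p) \<longlonglongrightarrow> 0"
proof -
  have \<sigma>: "\<And>n. 0 < mesh (\<sigma> n)" "(\<lambda>n. mesh (\<sigma> n)) \<longlonglongrightarrow> 0"
    using assms mesh_pos by (auto simp: vanishing_partitions_def)
  have "(\<lambda>n. osc T x (mesh (\<sigma> n))) \<longlonglongrightarrow> 0"
    using assms \<sigma> by (intro osc_tendsto_0) (auto intro: less_imp_le)
  then show ?thesis
    using assms(1-3) \<sigma>(1) by (intro tendsto_zero_powrI[of _ _ _ p] tendsto_const osc_nonneg always_eventually allI)
      (auto intro: less_imp_le)
qed

lemma is_variation_limit_measure_on_interval:
  "is_variation_limit T p \<sigma> x \<mu> \<Longrightarrow> measure_on_interval \<mu> T"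
  by (simp add: is_variation_limit_def measure_on_interval_def measure_on_interval_axioms_def)

text \<open>Nonatomicity makes every \<open>t\<close> a continuity point, so there are no
  exceptional times.\<close>

lemma is_variation_limit_tendsto:
  assumes "vanishing_partitions T \<sigma>" and \<mu>: "is_variation_limit T p \<sigma> x \<mu>" and t: "t \<in> {0..T}"
  shows "(\<lambda>n. measure (variation_measure T p x (\<sigma> n)) {0..t}) \<longlonglongrightarrow> measure \<mu> {0..t}"
proof -
  have M: "measure_on_interval (variation_measure T p x (\<sigma> n)) T" for n
    using assms(1) by (simp add: measure_on_interval_variation_measure vanishing_partitions_def)
  have \<mu>': "measure_on_interval \<mu> T"
    using \<mu> by (rule is_variation_limit_measure_on_interval)
  have "(\<lambda>n. cdf_on (variation_measure T p x (\<sigma> n)) t) \<longlonglongrightarrow> cdf_on \<mu> t"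
    using \<mu> by (intro weakly_converges_on_imp_cdf_tendsto[OF M \<mu>'] measure_on_interval.nonatomic_isCont_cdf_on[OF \<mu>'])
      (auto simp: is_variation_limit_def)
  then show ?thesis
    using t by (simp add: measure_on_interval.cdf_on_eq[OF M] measure_on_interval.cdf_on_eq[OF \<mu>'])
qed

text \<open>The description in \<open>pvar\<close> is proper: the approximating masses of
  \<open>{0..t}\<close> fix those of any limit, and these fix the measure.\<close>

lemma pvar_eq:
  assumes "vanishing_partitions T \<sigma>" and \<mu>: "is_variation_limit T p \<sigma> x \<mu>"
  shows "pvar T p \<sigma> x t = measure \<mu> {0..t}"
proof -
  have "(THE \<mu>. is_variation_limit T p \<sigma> x \<mu>) = \<mu>"
  proof (rule the_equality[of "is_variation_limit T p \<sigma> x", OF \<mu>])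
    fix \<nu> assume \<nu>: "is_variation_limit T p \<sigma> x \<nu>"
    show "\<nu> = \<mu>"
      by (rule measure_on_interval_eqI[OF is_variation_limit_measure_on_interval[OF \<nu>]
            is_variation_limit_measure_on_interval[OF \<mu>]])
        (rule LIMSEQ_unique[OF is_variation_limit_tendsto[OF assms(1) \<nu>] is_variation_limit_tendsto[OF assms(1) \<mu>]])
  qed
  then show ?thesis by (simp add: pvar_def)
qed

text \<open>\<open>stopped_var\<close> can fail to be monotone in \<open>t\<close>. Uniformity is
  therefore obtained for the masses of \<open>{0..t}\<close> and transferred by
  \<open>stopped_var_close\<close>, whose error bound is independent of \<open>t\<close>.\<close>

lemma stopped_var_uniform_limit:
  assumes "0 < T" "0 < p" "continuous_on {0..T} x" "vanishing_partitions T \<sigma>"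
    and \<mu>: "is_variation_limit T p \<sigma> x \<mu>"
  shows "uniform_limit {0..T} (\<lambda>n. stopped_var p (\<sigma> n) x) (\<lambda>t. measure \<mu> {0..t}) sequentially"
proof (rule uniform_limitI)
  fix e :: real assume e: "0 < e"
  have part: "is_partition T (\<sigma> n)" for n using assms(4) by (simp add: vanishing_partitions_def)
  let ?M = "\<lambda>n. variation_measure T p x (\<sigma> n)"
  have M: "measure_on_interval (?M n) T" for n
    by (intro measure_on_interval_variation_measure part)
  have \<mu>': "measure_on_interval \<mu> T"
    using \<mu> by (rule is_variation_limit_measure_on_interval)
  have "uniform_limit {0..T} (\<lambda>n t. measure (?M n) {0..t}) (\<lambda>t. measure \<mu> {0..t}) sequentially"
  proof (rule mono_tendsto_imp_uniform_limit)
    show "mono_on {0..T} (\<lambda>t. measure (?M n) {0..t})" for n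
    proof -
      interpret measure_on_interval "?M n" T by (rule M)
      show ?thesis by (intro mono_onI finite_measure_mono sets_MI) auto
    qed
    show "(\<lambda>n. measure (?M n) {0..t}) \<longlonglongrightarrow> measure \<mu> {0..t}" if "t \<in> {0..T}" for t
      using assms(4) \<mu> that by (rule is_variation_limit_tendsto)
    have "continuous_on {0..T} (cdf_on \<mu>)"
      using \<mu> by (intro continuous_at_imp_continuous_on ballI measure_on_interval.nonatomic_isCont_cdf_on[OF \<mu>'])
        (auto simp: is_variation_limit_def)
    then show "continuous_on {0..T} (\<lambda>t. measure \<mu> {0..t})"
      by (rule continuous_on_eq) (simp add: measure_on_interval.cdf_on_eq[OF \<mu>'])
  qed
  then have "\<forall>\<^sub>F n in sequentially. \<forall>t\<in>{0..T}. dist (measure (?M n) {0..t}) (measure \<mu> {0..t}) < e / 2"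
    using e by (intro uniform_limitD) auto
  moreover have "\<forall>\<^sub>F n in sequentially. osc T x (mesh (\<sigma> n)) powr p < e / 2"
    using e by (intro order_tendstoD(2)[OF osc_mesh_powr_tendsto_0[OF assms(1-4)]]) auto
  ultimately show "\<forall>\<^sub>F n in sequentially. \<forall>t\<in>{0..T}. dist (stopped_var p (\<sigma> n) x t) (measure \<mu> {0..t}) < e"
  proof eventually_elim
    case (elim n)
    show ?case
    proof
      fix t assume t: "t \<in> {0..T}"
      have "\<bar>measure (?M n) {0..t} - measure \<mu> {0..t}\<bar> < e / 2"
        using elim(1) t by (simp add: dist_real_def)
      moreover have "\<bar>measure (?M n) {0..t} - stopped_var p (\<sigma> n) x t\<bar> \<le> osc T x (mesh (\<sigma> n)) powr p"
        using assms(2) by (intro stopped_var_close assms t part) simp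
      ultimately show "dist (stopped_var p (\<sigma> n) x t) (measure \<mu> {0..t}) < e"
        using elim(2) unfolding dist_real_def by linarith
    qed
  qed
qed

text \<open>The converse criterion: pointwise convergence suffices. It serves to recognise the limit
  measure along \<open>\<rho>\<close> as the limit along \<open>\<pi>\<close>.\<close>

lemma is_variation_limitI:
  assumes "0 < T" "0 < p" "continuous_on {0..T} x" "vanishing_partitions T \<sigma>"
    and \<mu>: "measure_on_interval \<mu> T" "nonatomic \<mu>"
    and lim: "\<And>t. t \<in> {0..T} \<Longrightarrow> (\<lambda>n. stopped_var p (\<sigma> n) x t) \<longlonglongrightarrow> measure \<mu> {0..t}"
  shows "is_variation_limit T p \<sigma> x \<mu>"
proof -
  have part: "is_partition T (\<sigma> n)" for n using assms(4) by (simp add: vanishing_partitions_def)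
  let ?M = "\<lambda>n. variation_measure T p x (\<sigma> n)"
  have "weakly_converges_on T ?M \<mu>"
  proof (rule weakly_converges_onI[OF assms(1) measure_on_interval_variation_measure[OF part] \<mu>(1)])
    fix t assume t: "t \<in> {0..T}"
    have "(\<lambda>n. measure (?M n) {0..t} - stopped_var p (\<sigma> n) x t) \<longlonglongrightarrow> 0"
      using assms(2) by (intro Lim_null_comparison[OF _ osc_mesh_powr_tendsto_0[OF assms(1-4)]] always_eventually allI)
        (auto intro!: stopped_var_close assms t part)
    from tendsto_add[OF this lim[OF t]]
    show "(\<lambda>n. measure (?M n) {0..t}) \<longlonglongrightarrow> measure \<mu> {0..t}" by simp
  qed
  with \<mu> show ?thesis
    by (simp add: is_variation_limit_def measure_on_interval_def measure_on_interval_axioms_def)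
qed

subsection \<open>Coarse-graining\<close>

text \<open>Convexity of \<open>y powr p\<close> at \<open>b + e = (1 - \<theta>) * (b / (1 - \<theta>)) + \<theta> * (e / \<theta>)\<close>; together with
  \<open>\<theta> \<rightarrow> 0\<close> this serves as a substitute for Minkowski's inequality.\<close>

lemma powr_add_le:
  fixes b e p \<theta> :: real
  assumes "1 \<le> p" "0 < \<theta>" "\<theta> < 1"
  shows "\<bar>b + e\<bar> powr p \<le> (1 - \<theta>) powr (1 - p) * \<bar>b\<bar> powr p + \<theta> powr (1 - p) * \<bar>e\<bar> powr p"
proof -
  have split: "c * (y / c) powr p = c powr (1 - p) * y powr p" if "0 < c" "0 \<le> y" for c y :: real
    using that by (simp add: powr_divide powr_diff)
  have ge1: "1 \<le> c powr (1 - p)" if "0 < c" "c < 1" for c :: real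
    using that assms(1) powr_mono_both'[of "1 - p" 0 1 c] powr_mono'[of "1 - p" 0 c] by simp
  \<comment> \<open>Convexity is applied at strictly positive points only. In the degenerate cases
    the surviving term has a factor at least 1, because the exponent \<open>1 - p\<close> is
    nonpositive.\<close>
  consider "b = 0" | "e = 0" | "b \<noteq> 0" "e \<noteq> 0" by blast
  then show ?thesis
  proof cases
    case 1
    then show ?thesis
      using ge1[OF assms(2,3)] mult_right_mono[of 1 "\<theta> powr (1 - p)" "\<bar>e\<bar> powr p"] by simp
  next
    case 2
    then show ?thesis
      using ge1[of "1 - \<theta>"] assms mult_right_mono[of 1 "(1 - \<theta>) powr (1 - p)" "\<bar>b\<bar> powr p"] by simp
  next
    case 3
    let ?u = "\<bar>b\<bar> / (1 - \<theta>)" and ?v = "\<bar>e\<bar> / \<theta>"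
    have pos: "0 < ?u" "0 < ?v" using 3 assms by auto
    have "\<bar>b + e\<bar> powr p \<le> (\<bar>b\<bar> + \<bar>e\<bar>) powr p"
      using assms(1) by (intro powr_mono2) auto
    also have "\<bar>b\<bar> + \<bar>e\<bar> = (1 - \<theta>) * ?u + \<theta> * ?v" using assms by simp
    also have "\<dots> powr p \<le> (1 - \<theta>) * ?u powr p + \<theta> * ?v powr p"
      using convex_onD[OF powr_convex[OF assms(1)], of \<theta> ?u ?v] pos assms by simp
    also have "\<dots> = (1 - \<theta>) powr (1 - p) * \<bar>b\<bar> powr p + \<theta> powr (1 - p) * \<bar>e\<bar> powr p"
      using assms by (simp add: split)
    finally show ?thesis .
  qed
qed

text \<open>\<open>powr_add_le\<close> is used termwise in both directions, once with
  \<open>a\<close> as a perturbation of \<open>b\<close> and once with the roles exchanged.\<close>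

lemma sum_powr_perturb:
  fixes a b :: "'i \<Rightarrow> real"
  assumes "1 \<le> p" "0 < \<theta>" "\<theta> < 1"
  shows "\<bar>(\<Sum>k\<in>I. \<bar>a k\<bar> powr p) - (\<Sum>k\<in>I. \<bar>b k\<bar> powr p)\<bar>
    \<le> ((1 - \<theta>) powr (1 - p) - 1) * (\<Sum>k\<in>I. \<bar>b k\<bar> powr p) + \<theta> powr (1 - p) * (\<Sum>k\<in>I. \<bar>a k - b k\<bar> powr p)"
proof -
  define c d where "c = (1 - \<theta>) powr (1 - p)" and "d = \<theta> powr (1 - p)"
  have le: "(\<Sum>k\<in>I. \<bar>a k\<bar> powr p) \<le> c * (\<Sum>k\<in>I. \<bar>b k\<bar> powr p) + d * (\<Sum>k\<in>I. \<bar>a k - b k\<bar> powr p)" for a b :: "'i \<Rightarrow> real"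
  proof -
    have "(\<Sum>k\<in>I. \<bar>a k\<bar> powr p) \<le> (\<Sum>k\<in>I. c * \<bar>b k\<bar> powr p + d * \<bar>a k - b k\<bar> powr p)"
      using powr_add_le[OF assms, of "b k" "a k - b k" for k] by (intro sum_mono) (simp add: c_def d_def)
    then show ?thesis by (simp add: sum.distrib sum_distrib_left)
  qed
  let ?A = "\<Sum>k\<in>I. \<bar>a k\<bar> powr p" and ?B = "\<Sum>k\<in>I. \<bar>b k\<bar> powr p" and ?E = "\<Sum>k\<in>I. \<bar>a k - b k\<bar> powr p"
  have c: "1 \<le> c"
    using assms powr_mono'[of "1 - p" 0 "1 - \<theta>"] by (simp add: c_def)
  have nn: "0 \<le> ?E" "0 \<le> ?B" "0 \<le> d" by (auto intro!: sum_nonneg simp: d_def)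
  have 1: "?A \<le> c * ?B + d * ?E" by (rule le)
  have 2: "?B \<le> c * ?A + d * ?E" using le[of b a] by (simp add: abs_minus_commute)
  have "\<bar>?A - ?B\<bar> \<le> (c - 1) * ?B + d * ?E"
  proof (cases "?A \<le> ?B")
    case True
    \<comment> \<open>Fact \<open>2\<close> bounds \<open>?B - ?A\<close> by
      \<open>(c - 1) * ?A + d * ?E\<close>; replacing \<open>?A\<close> by the larger
      \<open>?B\<close> leaves only the sum over \<open>b\<close> on the right.\<close>
    then have "(c - 1) * ?A \<le> (c - 1) * ?B" using c by (intro mult_left_mono) auto
    then show ?thesis using True 2 by (simp add: algebra_simps)
  next
    case False
    then show ?thesis using 1 by (simp add: algebra_simps)
  qed
  then show ?thesis by (simp add: c_def d_def)
qed

text \<open>The order of choices matters: \<open>\<theta>\<close> is fixed first to make the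
  relative error small, and only then \<open>n\<close> grows, so that \<open>\<eta> n\<close> beats
  the possibly huge factor \<open>\<theta> powr (1 - p)\<close>.\<close>

lemma uniform_limit_sum_powr_perturb:
  fixes a b :: "nat \<Rightarrow> 'i \<Rightarrow> 'a \<Rightarrow> real"
  assumes p: "1 \<le> p"
    and lim: "uniform_limit S (\<lambda>n t. \<Sum>k\<in>I n. \<bar>b n k t\<bar> powr p) g sequentially"
    and bound: "\<And>t. t \<in> S \<Longrightarrow> \<bar>g t\<bar> \<le> L"
    and \<eta>: "\<eta> \<longlonglongrightarrow> 0"
    and diff: "\<And>n t. t \<in> S \<Longrightarrow> (\<Sum>k\<in>I n. \<bar>a n k t - b n k t\<bar> powr p) \<le> \<eta> n"
  shows "uniform_limit S (\<lambda>n t. \<Sum>k\<in>I n. \<bar>a n k t\<bar> powr p) g sequentially"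
proof (rule uniform_limitI)
  fix e :: real assume e: "0 < e"
  let ?c = "\<lambda>\<theta>. (1 - \<theta>) powr (1 - p) - 1"
  have "((\<lambda>\<theta>. ?c \<theta> * (L + 1)) \<longlongrightarrow> ((1 - 0) powr (1 - p) - 1) * (L + 1)) (at_right 0)"
    by (intro tendsto_intros) auto
  then have "\<forall>\<^sub>F \<theta> in at_right 0. ?c \<theta> * (L + 1) < e / 3"
    using e by (intro order_tendstoD) auto
  moreover have "\<forall>\<^sub>F \<theta> in at_right 0. \<theta> \<in> {0<..<1::real}"
    by (rule eventually_at_right_real) simp
  ultimately obtain \<theta> where \<theta>: "?c \<theta> * (L + 1) < e / 3" "0 < \<theta>" "\<theta> < 1"
    using eventually_happens'[OF trivial_limit_at_right_real eventually_conj] by fastforce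
  have c: "0 \<le> ?c \<theta>"
    using p \<theta> powr_mono'[of "1 - p" 0 "1 - \<theta>"] by simp
  have "(\<lambda>n. \<theta> powr (1 - p) * \<eta> n) \<longlonglongrightarrow> \<theta> powr (1 - p) * 0"
    by (intro tendsto_intros \<eta>)
  then have "\<forall>\<^sub>F n in sequentially. \<theta> powr (1 - p) * \<eta> n < e / 3"
    using e by (intro order_tendstoD) auto
  \<comment> \<open>The 1 in the minimum bounds the sums over \<open>b\<close> by
    \<open>L + 1\<close>; \<open>e / 3\<close> is their share of the final error.\<close>
  moreover have "\<forall>\<^sub>F n in sequentially. \<forall>t\<in>S. dist (\<Sum>k\<in>I n. \<bar>b n k t\<bar> powr p) (g t) < min 1 (e / 3)"
    using lim e by (intro uniform_limitD) auto
  ultimately show "\<forall>\<^sub>F n in sequentially. \<forall>t\<in>S. dist (\<Sum>k\<in>I n. \<bar>a n k t\<bar> powr p) (g t) < e"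
  proof eventually_elim
    case (elim n)
    show ?case
    proof
      fix t assume t: "t \<in> S"
      let ?A = "\<Sum>k\<in>I n. \<bar>a n k t\<bar> powr p" and ?B = "\<Sum>k\<in>I n. \<bar>b n k t\<bar> powr p"
      have B: "\<bar>?B - g t\<bar> < 1" "\<bar>?B - g t\<bar> < e / 3"
        using elim(2) t by (auto simp: dist_real_def)
      then have "?c \<theta> * ?B \<le> ?c \<theta> * (L + 1)"
        using c bound[OF t] by (intro mult_left_mono) auto
      moreover have "\<theta> powr (1 - p) * (\<Sum>k\<in>I n. \<bar>a n k t - b n k t\<bar> powr p) \<le> \<theta> powr (1 - p) * \<eta> n"
        using diff[OF t] by (intro mult_left_mono) auto
      ultimately have "\<bar>?A - ?B\<bar> < e / 3 + e / 3"
        using sum_powr_perturb[OF p \<theta>(2,3), where I="I n" and a="\<lambda>k. a n k t" and b="\<lambda>k. b n k t"] \<theta>(1) elim(1)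
        by linarith
      with B(2) show "dist ?A (g t) < e"
        unfolding dist_real_def by linarith
    qed
  qed
qed

text \<open>The two boundary clauses of \<open>kappa\<close> agree with the general one: both
  partitions start at 0, and strict monotonicity lets \<open>ss\<close> reach \<open>T\<close> only
  at its last index.\<close>

lemma kappa_eq_Least:
  assumes "0 < T" "is_partition T ts" "is_partition T ss" "k \<le> num_intervals ts"
  shows "kappa ts ss k = (LEAST j. j \<le> num_intervals ss \<and> ss ! j \<ge> ts ! k)"
proof -
  note P = partition_points[OF assms(1,2)] and Q = partition_points[OF assms(1,3)]
  consider "k = 0" | "k = num_intervals ts" "k \<noteq> 0" | "k \<noteq> 0" "k \<noteq> num_intervals ts" by blast
  then show ?thesis
  proof cases
    case 1
    then show ?thesis using P(2) Q(2) by (auto simp: kappa_def intro!: Least_equality[symmetric])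
  next
    case 2
    have "j \<ge> num_intervals ss" if "j \<le> num_intervals ss" "T \<le> ss ! j" for j
      using Q(3) Q(4)[of j "num_intervals ss"] that by fastforce
    then show ?thesis
      using 2 P(3) Q(3) by (auto simp: kappa_def intro!: Least_equality[symmetric])
  qed (simp add: kappa_def)
qed

text \<open>By minimality the point of \<open>ss\<close> preceding \<open>ss ! kappa ts ss k\<close>
  lies below \<open>ts ! k\<close>, so the overshoot is at most one mesh. If there is no preceding
  point, the overshoot is not positive.\<close>

lemma kappa_props:
  assumes "0 < T" "is_partition T ts" "is_partition T ss" "k \<le> num_intervals ts"
  shows "kappa ts ss k \<le> num_intervals ss" "ts ! k \<le> ss ! kappa ts ss k"
    "ss ! kappa ts ss k - ts ! k \<le> mesh ss"
    "k < num_intervals ts \<Longrightarrow> kappa ts ss k \<le> kappa ts ss (Suc k)"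
proof -
  note P = partition_points[OF assms(1,2)] and Q = partition_points[OF assms(1,3)]
  let ?R = "\<lambda>k j. j \<le> num_intervals ss \<and> ss ! j \<ge> ts ! k"
  have ex: "?R k (num_intervals ss)" if "k \<le> num_intervals ts" for k
    using P(6)[OF that] Q(3) by simp
  have R: "?R k (kappa ts ss k)" if "k \<le> num_intervals ts" for k
    unfolding kappa_eq_Least[OF assms(1-3) that] by (rule LeastI[of "?R k", OF ex[OF that]])
  show "kappa ts ss k \<le> num_intervals ss" "ts ! k \<le> ss ! kappa ts ss k"
    using R[OF assms(4)] by auto
  show "ss ! kappa ts ss k - ts ! k \<le> mesh ss"
  proof (cases "kappa ts ss k")
    case 0
    then show ?thesis using Q(2) P(6)[OF assms(4)] mesh_pos[OF assms(1,3)] by simp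
  next
    case (Suc j)
    have "\<not> ?R k j"
      using not_less_Least[of j "?R k"] Suc kappa_eq_Least[OF assms] by simp
    then show ?thesis
      using R[OF assms(4)] mesh_ge[of j ss] Suc by auto
  qed
  show "kappa ts ss k \<le> kappa ts ss (Suc k)" if "k < num_intervals ts"
  proof -
    \<comment> \<open>The index chosen for \<open>Suc k\<close> is a candidate in the minimum
      defining the index for \<open>k\<close>.\<close>
    have "?R k (kappa ts ss (Suc k))"
      using R[of "Suc k"] P(4)[of k "Suc k"] that by auto
    then show ?thesis
      unfolding kappa_eq_Least[OF assms] by (rule Least_le)
  qed
qed

lemma sum_blocks:
  fixes f :: "nat \<Rightarrow> 'a :: comm_monoid_add"
  assumes "\<And>k. k < N \<Longrightarrow> \<kappa> k \<le> \<kappa> (Suc k)"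
  shows "(\<Sum>k<N. \<Sum>j=\<kappa> k..<\<kappa> (Suc k). f j) = (\<Sum>j=\<kappa> 0..<\<kappa> N. f j)"
  using assms
proof (induction N)
  case (Suc N)
  have "\<kappa> 0 \<le> \<kappa> N"
    using Suc.prems by (induction N) (auto intro: order_trans)
  then show ?case
    using Suc by (simp add: sum.atLeastLessThan_concat)
qed simp

text \<open>The blocks, some possibly empty, tile all indices of \<open>ss\<close>, so the inner
  sums assemble to the whole stopped variation.\<close>

lemma coarse_graining_error_eq:
  assumes "0 < T" "is_partition T ts" "is_partition T ss"
  shows "coarse_graining_error p ts ss x t
    = (\<Sum>k<num_intervals ts. \<bar>block_incr ts ss x k t\<bar> powr p) - stopped_var p ss x t"
proof -
  have "(\<Sum>k<num_intervals ts. \<Sum>j = kappa ts ss k..<kappa ts ss (Suc k). \<bar>stopped_incr ss x j t\<bar> powr p)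
      = (\<Sum>j=kappa ts ss 0..<kappa ts ss (num_intervals ts). \<bar>stopped_incr ss x j t\<bar> powr p)"
    using kappa_props(4)[OF assms] by (intro sum_blocks) auto
  also have "\<dots> = stopped_var p ss x t"
    using partition_points(1)[OF assms(1,2)] by (simp add: stopped_var_def kappa_def atLeast0LessThan)
  finally show ?thesis by (simp add: coarse_graining_error_def sum_subtractf)
qed

lemma block_incr_eq:
  assumes "0 < T" "is_partition T ts" "is_partition T ss" "k < num_intervals ts"
  shows "block_incr ts ss x k t = x (min (ss ! kappa ts ss (Suc k)) t) - x (min (ss ! kappa ts ss k) t)"
  unfolding block_incr_def stopped_incr_def
  using kappa_props(4)[OF assms(1-3) _ assms(4)] assms(4) by (intro sum_Suc_diff') simp

text \<open>One oscillation is paid at each end of the block. Stopping at \<open>t\<close> does not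
  increase distances, so the mesh bound on the overshoot survives it.\<close>

lemma block_incr_close:
  assumes "0 < T" "is_partition T ts" "is_partition T ss" "continuous_on {0..T} x" "t \<in> {0..T}"
    and k: "k < num_intervals ts"
  shows "\<bar>block_incr ts ss x k t - stopped_incr ts x k t\<bar> \<le> 2 * osc T x (mesh ss)"
proof -
  have *: "\<bar>x (min (ss ! kappa ts ss i) t) - x (min (ts ! i) t)\<bar> \<le> osc T x (mesh ss)"
    if i: "i \<le> num_intervals ts" for i
  proof (rule osc_bound[OF assms(4)])
    note K = kappa_props(1-3)[OF assms(1-3) i]
    have "ts ! i \<in> {0..T}" "ss ! kappa ts ss i \<in> {0..T}"
      using partition_points(6)[OF assms(1,2) i] partition_points(6)[OF assms(1,3) K(1)] by auto
    then show "min (ts ! i) t \<in> {0..T}" "min (ss ! kappa ts ss i) t \<in> {0..T}"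
      using assms(5) by auto
    show "\<bar>min (ss ! kappa ts ss i) t - min (ts ! i) t\<bar> \<le> mesh ss"
      using K(2,3) by (auto simp: min_def)
  qed
  show ?thesis
    using *[of k] *[of "Suc k"] k unfolding block_incr_eq[OF assms(1-3) k] stopped_incr_def by linarith
qed

lemma sum_block_incr_close:
  assumes "0 < T" "0 \<le> p" "is_partition T ts" "is_partition T ss" "continuous_on {0..T} x" "t \<in> {0..T}"
  shows "(\<Sum>k<num_intervals ts. \<bar>block_incr ts ss x k t - stopped_incr ts x k t\<bar> powr p)
    \<le> 2 powr p * (real (num_intervals ts) * osc T x (mesh ss) powr p)"
proof -
  have nn: "0 \<le> osc T x (mesh ss)"
    using mesh_pos[OF assms(1,4)] assms by (intro osc_nonneg) auto
  have "(\<Sum>k<num_intervals ts. \<bar>block_incr ts ss x k t - stopped_incr ts x k t\<bar> powr p)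
    \<le> real (card {..<num_intervals ts}) * (2 * osc T x (mesh ss)) powr p"
    using assms by (intro sum_bounded_above powr_mono2 block_incr_close) auto
  also have "\<dots> = 2 powr p * (real (num_intervals ts) * osc T x (mesh ss) powr p)"
    using nn by (simp add: powr_mult)
  finally show ?thesis .
qed

text \<open>The set \<open>S\<close> is left general so that \<open>{0..T}\<close> yields the
  uniform statement and a singleton the pointwise one. The two directions are the same perturbation
  read both ways.\<close>

lemma uniform_limit_block_iff:
  assumes "0 < T" "1 \<le> p" "continuous_on {0..T} x" "\<And>n. is_partition T (\<pi> n)" "\<And>n. is_partition T (\<rho> n)"
    and al: "is_alignment T p \<pi> \<rho> x r"
    and S: "S \<subseteq> {0..T}" and g: "\<And>t. t \<in> S \<Longrightarrow> \<bar>g t\<bar> \<le> L"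
  shows "uniform_limit S (\<lambda>n t. \<Sum>k<num_intervals (\<pi> n). \<bar>block_incr (\<pi> n) (\<rho> (r n)) x k t\<bar> powr p) g sequentially
    \<longleftrightarrow> uniform_limit S (\<lambda>n. stopped_var p (\<pi> n) x) g sequentially"
proof -
  let ?\<eta> = "\<lambda>n. 2 powr p * (real (num_intervals (\<pi> n)) * osc T x (mesh (\<rho> (r n))) powr p)"
  have "?\<eta> \<longlonglongrightarrow> 2 powr p * 0"
    using al unfolding is_alignment_def by (intro tendsto_intros) auto
  then have \<eta>: "?\<eta> \<longlonglongrightarrow> 0" by simp
  have le: "(\<Sum>k<num_intervals (\<pi> n). \<bar>block_incr (\<pi> n) (\<rho> (r n)) x k t - stopped_incr (\<pi> n) x k t\<bar> powr p) \<le> ?\<eta> n"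
    if "t \<in> S" for n t
    using assms that by (intro sum_block_incr_close) auto
  show ?thesis
    unfolding stopped_var_def
  proof
    assume "uniform_limit S (\<lambda>n t. \<Sum>k<num_intervals (\<pi> n). \<bar>block_incr (\<pi> n) (\<rho> (r n)) x k t\<bar> powr p) g sequentially"
    then show "uniform_limit S (\<lambda>n t. \<Sum>j<num_intervals (\<pi> n). \<bar>stopped_incr (\<pi> n) x j t\<bar> powr p) g sequentially"
      by (rule uniform_limit_sum_powr_perturb[OF assms(2) _ g \<eta>]) (use le in \<open>auto simp: abs_minus_commute\<close>)
  next
    assume "uniform_limit S (\<lambda>n t. \<Sum>j<num_intervals (\<pi> n). \<bar>stopped_incr (\<pi> n) x j t\<bar> powr p) g sequentially"
    then show "uniform_limit S (\<lambda>n t. \<Sum>k<num_intervals (\<pi> n). \<bar>block_incr (\<pi> n) (\<rho> (r n)) x k t\<bar> powr p) g sequentially"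
      by (rule uniform_limit_sum_powr_perturb[OF assms(2) _ g \<eta>]) (use le in auto)
  qed
qed

text \<open>For fixed \<open>n\<close> the factor \<open>num_intervals (\<pi> n)\<close> is
  constant, so the product tends to 0 along \<open>\<rho>\<close>. Dependent choice picks increasing
  indices at which it is below \<open>1 / (n + 1)\<close>.\<close>

lemma alignment_exists:
  assumes "0 < T" "0 < p" "continuous_on {0..T} x" "vanishing_partitions T \<rho>"
  shows "\<exists>r. is_alignment T p \<pi> \<rho> x r"
proof -
  let ?w = "\<lambda>n m. real (num_intervals (\<pi> n)) * osc T x (mesh (\<rho> m)) powr p"
  have "\<forall>\<^sub>F m in sequentially. ?w n m < inverse (real (Suc n))" for n
    using tendsto_mult_right_zero[OF osc_mesh_powr_tendsto_0[OF assms]]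
    by (intro order_tendstoD) auto
  then have ex: "\<exists>m. l < m \<and> ?w n m < inverse (real (Suc n))" for n l
    using eventually_happens'[OF sequentially_bot eventually_conj[OF eventually_gt_at_top[of l]]] by blast
  have "\<exists>r. \<forall>n. ?w n (r n) < inverse (real (Suc n)) \<and> r n < r (Suc n)"
    using ex by (intro dependent_nat_choice) blast+
  then obtain r where r: "\<And>n. ?w n (r n) < inverse (real (Suc n))" "\<And>n. r n < r (Suc n)"
    by blast
  have "(\<lambda>n. ?w n (r n)) \<longlonglongrightarrow> 0"
    using r(1) by (intro tendsto_sandwich[OF _ _ tendsto_const LIMSEQ_inverse_real_of_nat] always_eventually allI)
      (auto intro: less_imp_le)
  then show ?thesis
    using r(2) by (auto simp: is_alignment_def strict_mono_Suc_iff)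
qed

theorem proposition5p8:
  fixes T p :: real and \<pi> \<rho> :: "nat \<Rightarrow> real list" and x :: "real \<Rightarrow> real"
  assumes "0 < T" and "1 < p"
    and "vanishing_partitions T \<rho>" and "vanishing_partitions T \<pi>"
    and "continuous_on {0..T} x" and "x \<in> finite_pvar T p \<rho>"
  shows "((x \<in> finite_pvar T p \<pi> \<and> (\<forall>t\<in>{0..T}. pvar T p \<pi> x t = pvar T p \<rho> x t))
            \<longleftrightarrow> x \<in> coarse_graining_class T p \<pi> \<rho>)
       \<and> (x \<in> finite_pvar T p \<pi> \<and> (\<forall>t\<in>{0..T}. pvar T p \<pi> x t = pvar T p \<rho> x t) \<longrightarrow>
            (\<forall>r. is_alignment T p \<pi> \<rho> x r \<longrightarrow>
              (\<lambda>n. SUP t\<in>{0..T}. \<bar>coarse_graining_error p (\<pi> n) (\<rho> (r n)) x t\<bar>) \<longlonglongrightarrow> 0))"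
proof -
  have p: "0 < p" "1 \<le> p" using assms(2) by auto
  have part: "is_partition T (\<pi> n)" "is_partition T (\<rho> n)" for n
    using assms(3,4) by (auto simp: vanishing_partitions_def)
  obtain \<mu> where \<mu>: "is_variation_limit T p \<rho> x \<mu>"
    using assms(6) by (auto simp: finite_pvar_def)
  interpret \<mu>: measure_on_interval \<mu> T
    using \<mu> by (rule is_variation_limit_measure_on_interval)
  let ?g = "\<lambda>t. measure \<mu> {0..t}"
  have g: "\<bar>?g t\<bar> \<le> measure \<mu> (space \<mu>)" for t
    by (simp add: \<mu>.bounded_measure)
  let ?A = "\<lambda>r n t. \<Sum>k<num_intervals (\<pi> n). \<bar>block_incr (\<pi> n) (\<rho> (r n)) x k t\<bar> powr p"
  have R: "coarse_graining_error p (\<pi> n) (\<rho> m) x t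
      = (\<Sum>k<num_intervals (\<pi> n). \<bar>block_incr (\<pi> n) (\<rho> m) x k t\<bar> powr p) - stopped_var p (\<rho> m) x t" for n m t
    by (rule coarse_graining_error_eq[OF assms(1) part])
  have \<rho>lim: "uniform_limit {0..T} (\<lambda>n. stopped_var p (\<rho> (r n)) x) ?g sequentially"
    if "is_alignment T p \<pi> \<rho> x r" for r
    using filterlim_compose[OF stopped_var_uniform_limit[OF assms(1) p(1) assms(5,3) \<mu>] filterlim_subseq[of r]] that
    by (simp add: is_alignment_def)
  have block_iff: "uniform_limit S (?A r) ?g sequentially \<longleftrightarrow> uniform_limit S (\<lambda>n. stopped_var p (\<pi> n) x) ?g sequentially"
    if "is_alignment T p \<pi> \<rho> x r" "S \<subseteq> {0..T}" for r S
    using uniform_limit_block_iff[OF assms(1) p(2) assms(5) part that g] .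
  let ?lhs = "x \<in> finite_pvar T p \<pi> \<and> (\<forall>t\<in>{0..T}. pvar T p \<pi> x t = pvar T p \<rho> x t)"
  \<comment> \<open>Proved for an arbitrary alignment, this gives both the uniform claim and,
    applied to one existing alignment, membership in the class.\<close>
  have err: "uniform_limit {0..T} (\<lambda>n. coarse_graining_error p (\<pi> n) (\<rho> (r n)) x) (\<lambda>_. 0) sequentially"
    if lhs: ?lhs and r: "is_alignment T p \<pi> \<rho> x r" for r
  proof -
    obtain \<nu> where \<nu>: "is_variation_limit T p \<pi> x \<nu>"
      using lhs by (auto simp: finite_pvar_def)
    have eq: "measure \<nu> {0..t} = ?g t" if "t \<in> {0..T}" for t
      using lhs that pvar_eq[OF assms(4) \<nu>] pvar_eq[OF assms(3) \<mu>] by simp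
    have "uniform_limit {0..T} (\<lambda>n. stopped_var p (\<pi> n) x) ?g sequentially"
      using stopped_var_uniform_limit[OF assms(1) p(1) assms(5,4) \<nu>]
      by (rule uniform_limit_cong'[THEN iffD1, rotated -1]) (auto simp: eq)
    then have "uniform_limit {0..T} (?A r) ?g sequentially"
      by (simp add: block_iff[OF r])
    from uniform_limit_minus[OF this \<rho>lim[OF r]] show ?thesis
      by (simp add: R[abs_def])
  qed
  have "x \<in> coarse_graining_class T p \<pi> \<rho>" if ?lhs
  proof -
    obtain r where r: "is_alignment T p \<pi> \<rho> x r"
      using alignment_exists[OF assms(1) p(1) assms(5,3)] by blast
    then show ?thesis
      using assms(6) tendsto_uniform_limitI[OF err[OF that r]] by (auto simp: coarse_graining_class_def)
  qed
  moreover have ?lhs if "x \<in> coarse_graining_class T p \<pi> \<rho>"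
  proof -
    obtain r where r: "is_alignment T p \<pi> \<rho> x r"
      and lim: "\<And>t. t \<in> {0..T} \<Longrightarrow> (\<lambda>n. coarse_graining_error p (\<pi> n) (\<rho> (r n)) x t) \<longlonglongrightarrow> 0"
      using \<open>x \<in> coarse_graining_class T p \<pi> \<rho>\<close> by (auto simp: coarse_graining_class_def)
    \<comment> \<open>The limit measure along \<open>\<rho>\<close> itself is the witness, so
      equality of the two variations is immediate afterwards.\<close>
    have "is_variation_limit T p \<pi> x \<mu>"
    proof (rule is_variation_limitI[OF assms(1) p(1) assms(5,4) \<mu>.measure_on_interval_axioms])
      show "nonatomic \<mu>" using \<mu> by (simp add: is_variation_limit_def)
      fix t assume t: "t \<in> {0..T}"
      have "(\<lambda>n. ?A r n t) \<longlonglongrightarrow> ?g t"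
        using tendsto_add[OF lim[OF t] tendsto_uniform_limitI[OF \<rho>lim[OF r] t]] by (simp add: R)
      \<comment> \<open>Only pointwise convergence is at hand here, so the equivalence is used on
        the singleton \<open>{t}\<close>.\<close>
      then show "(\<lambda>n. stopped_var p (\<pi> n) x t) \<longlonglongrightarrow> ?g t"
        using block_iff[OF r, of "{t}"] t by (simp add: uniform_limit_singleton)
    qed
    then show ?lhs
      using pvar_eq[OF assms(4)] pvar_eq[OF assms(3) \<mu>] by (auto simp: finite_pvar_def)
  qed
  moreover have "(\<lambda>n. SUP t\<in>{0..T}. \<bar>coarse_graining_error p (\<pi> n) (\<rho> (r n)) x t\<bar>) \<longlonglongrightarrow> 0"
    if "?lhs" "is_alignment T p \<pi> \<rho> x r" for r
  proof (rule tendstoI)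
    fix e :: real assume e: "0 < e"
    have "\<forall>\<^sub>F n in sequentially. \<forall>t\<in>{0..T}. dist (coarse_graining_error p (\<pi> n) (\<rho> (r n)) x t) 0 < e / 2"
      using err[OF that] e by (intro uniform_limitD) auto
    then show "\<forall>\<^sub>F n in sequentially. dist (SUP t\<in>{0..T}. \<bar>coarse_graining_error p (\<pi> n) (\<rho> (r n)) x t\<bar>) 0 < e"
    proof eventually_elim
      case (elim n)
      let ?R = "\<lambda>t. \<bar>coarse_graining_error p (\<pi> n) (\<rho> (r n)) x t\<bar>"
      have le: "?R t \<le> e / 2" if "t \<in> {0..T}" for t
        using elim that by (simp add: less_imp_le)
      then have "(SUP t\<in>{0..T}. ?R t) \<le> e / 2"
        using assms(1) by (intro cSUP_least) auto
      \<comment> \<open>The value at \<open>0\<close> shows that the supremum is nonnegative, as the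
        distance to 0 requires.\<close>
      moreover have "?R 0 \<le> (SUP t\<in>{0..T}. ?R t)"
        using assms(1) le by (intro cSUP_upper bdd_aboveI2[where M="e / 2"]) auto
      ultimately show ?case
        using e unfolding dist_real_def by linarith
    qed
  qed
  ultimately show ?thesis by blast
qed

end
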